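(* For all integers $0\le k\le n$, the probability $r_{k,n}=\mathbb{P}\{T_n=k\}$ is given by $$\begin{aligned} r_{k,n}={}&\mathbf{1}_{\mathcal{E}}(n-k)\Bigg[2p\sum_{\substack{i\in\mathcal{E}:\\ n-k\le i\le n}}a_i(pq)^{i/2}-4\sum_{\substack{i\in\mathcal{E}:\\ n-k\le i\le n-2}}\bigg(\sum_{\substack{j\in\mathcal{E}:\\ j\le i+k-n}}a_ja_{i-j}\bigg)(pq)^{i/2+1}\Bigg]\\ &+\mathbf{1}_{\mathcal{E}}(k)\Bigg[2q\sum_{\substack{i\in\mathcal{E}:\\ k\le i\le n}}a_i(pq)^{i/2}-4\sum_{\substack{i\in\mathcal{E}:\\ k\le i\le n-2}}\bigg(\sum_{\substack{j\in\mathcal{E}:\\ j\le i-k}}a_ja_{i-j}\bigg)(pq)^{i/2+1}\Bigg].\end{aligned}$$ More specifically: (a) For odd $n$: if $k$ is odd, $$r_{k,n}=2p\sum_{\substack{i\in\mathcal{E}:\\ n-k\le i\le n-1}}a_i(pq)^{i/2}-4\sum_{\substack{i\in\mathcal{E}:\\ n-k\le i\le n-3}}\bigg(\sum_{\substack{j\in\mathcal{E}:\\ j\le i+k-n}}a_ja_{i-j}\bigg)(pq)^{i/2+1},$$ and if $k$ is even, $$r_{k,n}=2q\sum_{\substack{i\in\mathcal{E}:\\ k\le i\le n-1}}a_i(pq)^{i/2}-4\sum_{\substack{i\in\mathcal{E}:\\ k\le i\le n-3}}\bigg(\sum_{\substack{j\in\mathcal{E}:\\ j\le i-k}}a_ja_{i-j}\bigg)(pq)^{i/2+1}.$$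 (b) For even $n$: if $k$ is even, $$\begin{aligned}r_{k,n}={}&2p\sum_{\substack{i\in\mathcal{E}:\\ n-k\le i\le n}}a_i(pq)^{i/2}-4\sum_{\substack{i\in\mathcal{E}:\\ n-k\le i\le n-2}}\bigg(\sum_{\substack{j\in\mathcal{E}:\\ j\le i+k-n}}a_ja_{i-j}\bigg)(pq)^{i/2+1}\\&+2q\sum_{\substack{i\in\mathcal{E}:\\ k\le i\le n}}a_i(pq)^{i/2}-4\sum_{\substack{i\in\mathcal{E}:\\ k\le i\le n-2}}\bigg(\sum_{\substack{j\in\mathcal{E}:\\ j\le i-k}}a_ja_{i-j}\bigg)(pq)^{i/2+1},\end{aligned}$$ and $r_{k,n}=0$ if $k$ is odd.
   Context: Let $p\in(0,1)$, $q=1-p$, and let $(X_k)_{k\ge1}$ be independent random variables with $\mathbb{P}\{X_k=1\}=p$, $\mathbb{P}\{X_k=-1\}=q$. Let $S_0=0$ and $S_k=\sum_{j=1}^kX_j$ for $k\ge1$ (Bernoulli random walk on $\mathbb{Z}$). The modified sojourn time is $T_0=0$ and $T_n=\sum_{j=1}^n\delta_j$ for $n\ge1$, where $\delta_j=1$ if ($S_j>0$) or ($S_j=0$ and $S_{j-1}>0$), and $\delta_j=0$ if ($S_j<0$) or ($S_j=0$ and $S_{j-1}<0$). Notation: $\mathcal{E}=\{0,2,4,\dots\}$, $\mathbf{1}_{\mathcal{E}}$ is its indicator function, and $a_i=\frac{1}{i+2}\binom{i}{i/2}$ for $i\in\mathcal{E}$. Empty sums are $0$. *)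

theory Defs
  imports "HOL-Probability.Probability"
begin

text \<open>The step \<open>X 0\<close> is never used: the walk sums the steps \<open>X 1, \<dots>, X k\<close>.\<close>

definition walk :: "(nat \<Rightarrow> 'w \<Rightarrow> int) \<Rightarrow> nat \<Rightarrow> 'w \<Rightarrow> int" where
  "walk X k \<omega> = (\<Sum>j=1..k. X j \<omega>)"

text \<open>Meant for \<open>j \<ge> 1\<close>. For steps \<open>\<plusminus>1\<close> the two cases \<open>S j > 0 \<or> S j = 0 \<and> S (j - 1) > 0\<close> and
  \<open>S j < 0 \<or> S j = 0 \<and> S (j - 1) < 0\<close> are complementary, so the second one is the \<open>else\<close> branch.\<close>

definition pos_step :: "(nat \<Rightarrow> 'w \<Rightarrow> int) \<Rightarrow> nat \<Rightarrow> 'w \<Rightarrow> nat" where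
  "pos_step X j \<omega> =
     (if walk X j \<omega> > 0 \<or> walk X j \<omega> = 0 \<and> walk X (j - 1) \<omega> > 0 then 1 else 0)"

definition sojourn :: "(nat \<Rightarrow> 'w \<Rightarrow> int) \<Rightarrow> nat \<Rightarrow> 'w \<Rightarrow> nat" where
  "sojourn X n \<omega> = (\<Sum>j=1..n. pos_step X j \<omega>)"

definition sojourn_prob :: "'w measure \<Rightarrow> (nat \<Rightarrow> 'w \<Rightarrow> int) \<Rightarrow> nat \<Rightarrow> nat \<Rightarrow> real" where
  "sojourn_prob M X k n = \<P>(\<omega> in M. sojourn X n \<omega> = k)"

definition Evens :: "nat set" where
  "Evens = {i. even i}"

text \<open>Only used at even \<open>i\<close>, where \<open>i div 2\<close> is exact.\<close>

definition acoeff :: "nat \<Rightarrow> real" where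
  "acoeff i = 1 / real (i + 2) * real (i choose (i div 2))"

end

theory Submission imports Defs begin

text \<open>Split a path with \<open>k\<close> positive and \<open>l = n - k\<close> negative steps at its last visit \<open>2 * m\<close> to
  \<open>0\<close>. If the walk is positive afterwards, all \<open>l\<close> negative steps come before that time, so \<open>l\<close> is
  even and \<open>l \<le> 2 * m\<close>; by the Chung-Feller theorem the bridges of length \<open>2 * m\<close> with \<open>l\<close> negative
  steps have total weight \<open>C\<^sub>m (p q)\<^sup>m\<close>, independently of \<open>l\<close>, where \<open>C\<^sub>m = 2 a\<^sub>2\<^sub>m\<close> is a Catalan number.
  The remaining part stays positive for \<open>h = n - 2 * m > 0\<close> steps with probability
  \<open>p\<close> minus the sum of \<open>C\<^sub>i (p q)\<^sup>i\<^sup>+\<^sup>1\<close> over \<open>2 * i + 2 \<le> h\<close>. The resulting law of the pair (position, sojourn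
  time) is verified by induction on \<open>n\<close>; at position \<open>0\<close> the step is the Catalan convolution.\<close>

section \<open>Catalan numbers and their convolution\<close>

definition catalan :: "nat \<Rightarrow> real" where
  "catalan n = real ((2 * n) choose n) / real (n + 1)"

lemma catalan_0 [simp]: "catalan 0 = 1"
  by (simp add: catalan_def)

lemma acoeff_even: "acoeff (2 * m) = catalan m / 2"
  by (simp add: acoeff_def catalan_def field_simps)

lemma catalan_Suc: "real (n + 2) * catalan (Suc n) = 2 * real (2 * n + 1) * catalan n"
proof -
  have "Suc n * (2 * Suc n choose Suc n) = Suc n * (2 * (Suc (2 * n) choose n))"
    using Suc_times_binomial_eq[of "Suc (2 * n)" n] by (simp del: binomial_Suc_Suc add: algebra_simps)
  then have "2 * Suc n choose Suc n = 2 * (Suc (2 * n) choose n)"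
    using mult_cancel1[of "Suc n"] by blast
  moreover have "Suc n * (Suc (2 * n) choose n) = Suc (2 * n) * (2 * n choose n)"
    using binomial_absorb_comp[of "Suc (2 * n)" n] by (simp add: Suc_diff_le)
  ultimately have "Suc n * (2 * Suc n choose Suc n) = 2 * Suc (2 * n) * (2 * n choose n)"
    by (simp only: mult.left_commute mult.assoc)
  then have "real (Suc n) * real (2 * Suc n choose Suc n) = 2 * real (Suc (2 * n)) * real (2 * n choose n)"
    unfolding of_nat_mult[symmetric] of_nat_numeral[symmetric, where ?'a = real] by (simp only: of_nat_eq_iff)
  then show ?thesis
    unfolding catalan_def by (simp del: binomial_Suc_Suc mult_Suc_right add: divide_simps mult_ac)
qed

text \<open>Pairing \<open>i\<close> with \<open>n - i\<close> turns the factor \<open>i\<close> into \<open>n / 2\<close>; applying the first-order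
  recurrence of the Catalan numbers to one factor then gives
  \<open>(n / 2 + 1) * S n = catalan n + 2 * n * S (n - 1)\<close> for the convolution \<open>S\<close>.\<close>

lemma catalan_convolution: "(\<Sum>i\<le>n. catalan i * catalan (n - i)) = catalan (Suc n)"
proof (induction n)
  case 0
  show ?case by (simp add: catalan_def)
next
  case (Suc n)
  define S where "S = (\<lambda>n. \<Sum>i\<le>n. catalan i * catalan (n - i))"
  define T where "T = (\<lambda>n. \<Sum>i\<le>n. real i * (catalan i * catalan (n - i)))"
  have T: "2 * T n = real n * S n" for n
  proof -
    have "T n = (\<Sum>i\<le>n. real (n - i) * (catalan (n - i) * catalan (n - (n - i))))"
      unfolding T_def by (rule sum.reindex_bij_witness[where i = "\<lambda>i. n - i" and j = "\<lambda>i. n - i"]) auto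
    also have "\<dots> = (\<Sum>i\<le>n. real (n - i) * (catalan i * catalan (n - i)))"
      by (intro sum.cong) (auto simp: mult.commute)
    finally have "2 * T n = T n + (\<Sum>i\<le>n. real (n - i) * (catalan i * catalan (n - i)))"
      by simp
    also have "\<dots> = (\<Sum>i\<le>n. (real i + real (n - i)) * (catalan i * catalan (n - i)))"
      unfolding T_def distrib_right sum.distrib ..
    also have "\<dots> = real n * S n"
      unfolding S_def sum_distrib_left by (intro sum.cong) auto
    finally show ?thesis .
  qed
  \<comment> \<open>Adding \<open>S\<close> raises the weight \<open>i\<close> to
    \<open>i + 1\<close>, which after the index shift is the factor \<open>i + 2\<close> that
    \<open>catalan_Suc\<close> absorbs.\<close>
  have "T (Suc n) + S (Suc n)
      = (\<Sum>i\<le>Suc n. real (i + 1) * catalan i * catalan (Suc n - i))"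
    unfolding T_def S_def sum.distrib[symmetric] by (intro sum.cong) (auto simp: algebra_simps)
  also have "\<dots> = catalan (Suc n)
      + (\<Sum>i\<le>n. real (i + 2) * catalan (Suc i) * catalan (n - i))"
    by (subst sum.atMost_Suc_shift) simp
  also have "(\<Sum>i\<le>n. real (i + 2) * catalan (Suc i) * catalan (n - i))
      = (\<Sum>i\<le>n. 4 * (real i * (catalan i * catalan (n - i))) + 2 * (catalan i * catalan (n - i)))"
    unfolding catalan_Suc by (intro sum.cong) (auto simp: algebra_simps)
  also have "\<dots> = 4 * T n + 2 * S n"
    unfolding T_def S_def sum.distrib sum_distrib_left ..
  finally have "real (n + 3) * S (Suc n) = 2 * catalan (Suc n) + 4 * real (n + 1) * S n"
    using T[of n] T[of "Suc n"] by (simp add: algebra_simps)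
  also have "\<dots> = 2 * real (2 * Suc n + 1) * catalan (Suc n)"
    using Suc.IH by (simp add: S_def algebra_simps)
  also have "\<dots> = real (n + 3) * catalan (Suc (Suc n))"
    using catalan_Suc[of "Suc n"] by (simp add: add.commute)
  finally show ?case by (simp add: S_def)
qed

section \<open>Paths that stay positive\<close>

text \<open>The total weight of the \<open>h\<close>-step paths from \<open>0\<close> to
  \<open>s\<close> that are positive at all times after \<open>0\<close>, built up by the last
  step.\<close>

fun meander :: "real \<Rightarrow> real \<Rightarrow> nat \<Rightarrow> nat \<Rightarrow> real" where
  "meander p q 0 s = (if s = 0 then 1 else 0)"
| "meander p q (Suc h) 0 = 0"
| "meander p q (Suc h) (Suc s) = p * meander p q h s + q * meander p q h (s + 2)"

lemma meander_parity: "odd (h + s) \<Longrightarrow> meander p q h s = 0"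
  by (induction p q h s rule: meander.induct) (auto intro: odd_pos)

lemma meander_gt: "h < s \<Longrightarrow> meander p q h s = 0"
  by (induction p q h s rule: meander.induct) auto

lemma meander_0: "h > 0 \<Longrightarrow> meander p q h 0 = 0"
  by (cases h) auto

text \<open>Ballot theorem: the first step must go up, and reflection leaves this difference for the
  other \<open>t + 2 * i\<close> steps. The proof removes the last step and uses Pascal's rule. The
  \<open>if\<close> guards against \<open>i - 1\<close> truncating to \<open>0\<close>.\<close>

lemma meander_ballot:
  "meander p q (t + 1 + 2 * i) (Suc t) =
     (real ((t + 2 * i) choose i) - (if i = 0 then 0 else real ((t + 2 * i) choose (i - 1))))
     * p ^ (t + 1 + i) * q ^ i"
proof (induction "t + 2 * i" arbitrary: t i)
  case 0
  then show ?case by simp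
next
  case (Suc h)
  have down: "q * meander p q (t + 2 * i) (t + 2) = (if i = 0 then 0 else
     (real (h choose (i - 1)) - (if i = 1 then 0 else real (h choose (i - 2)))) * p ^ (t + 1 + i) * q ^ i)"
  proof (cases i)
    case 0
    then show ?thesis by (simp add: meander_gt)
  next
    case (Suc i')
    then have h: "t + 2 * i = (t + 1) + 1 + 2 * i'" "h = (t + 1) + 2 * i'" "t + 2 = Suc (t + 1)"
      using Suc.hyps(2) by auto
    show ?thesis
      unfolding h(1,3) Suc.hyps(1)[OF h(2)] unfolding h(2)[symmetric]
      using Suc by (simp add: numeral_2_eq_2)
  qed
  have up: "p * meander p q (t + 2 * i) t = (if t = 0 then 0 else
     (real (h choose i) - (if i = 0 then 0 else real (h choose (i - 1)))) * p ^ (t + 1 + i) * q ^ i)"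
  proof (cases t)
    case 0
    then show ?thesis using Suc.hyps(2) by (metis add_0 meander.simps(2) mult_zero_right)
  next
    case t: (Suc t')
    then have h: "t + 2 * i = t' + 1 + 2 * i" "h = t' + 2 * i"
      using Suc.hyps(2) by auto
    show ?thesis
      using Suc.hyps(1)[OF h(2)] unfolding h(1) h(2)[symmetric] t by (simp del: meander.simps)
  qed
  have pascal: "real (Suc h choose i) = real (h choose i) + (if i = 0 then 0 else real (h choose (i - 1)))" for i
    by (cases i) auto
  \<comment> \<open>For \<open>t = 0\<close> the last step cannot go up, as \<open>0\<close> is
    forbidden. The formula stays valid because \<open>h = 2 * i - 1\<close> makes the missing
    difference zero by symmetry of the binomials.\<close>
  have mid: "h choose i = h choose (i - 1)" if "t = 0"
  proof -
    have "h - i = i - 1" "i \<le> h" using that Suc.hyps(2) by auto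
    then show ?thesis by (metis binomial_symmetric)
  qed
  have i0: "t \<noteq> 0" if "i = 0" using that Suc.hyps(2) by auto
  have "meander p q (t + 1 + 2 * i) (Suc t)
      = p * meander p q (t + 2 * i) t + q * meander p q (t + 2 * i) (t + 2)"
    by simp
  also have "\<dots> = (real (Suc h choose i) - (if i = 0 then 0 else real (Suc h choose (i - 1))))
     * p ^ (t + 1 + i) * q ^ i"
    unfolding up down pascal using mid i0 by (auto simp: algebra_simps numeral_2_eq_2)
  finally show ?case by (simp only: Suc.hyps(2))
qed

text \<open>A path counted here, closed by a down-step, is a positive excursion with first return at
  time \<open>2 * i + 2\<close>; the ballot number at \<open>t = 0\<close> is the Catalan
  number.\<close>

lemma meander_1: "q * meander p q (2 * i + 1) 1 = catalan i * (p * q) ^ (i + 1)"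
proof -
  have "real (2 * i choose i) - (if i = 0 then 0 else real (2 * i choose (i - 1))) = catalan i"
  proof (cases i)
    case (Suc j)
    have "Suc j * (2 * i choose Suc j) = (2 * i - j) * (2 * i choose j)"
      by (metis Suc_times_binomial_add binomial_absorb_comp binomial_absorption mult.commute)
    then have "real (i * (2 * i choose i)) = real ((i + 1) * (2 * i choose (i - 1)))"
      using Suc by simp
    then show ?thesis
      using Suc by (simp add: catalan_def field_simps del: binomial_Suc_Suc)
  qed simp
  then have "meander p q (2 * i + 1) 1 = catalan i * p ^ (i + 1) * q ^ i"
    using meander_ballot[of p q 0 i] by (simp only: add_0 One_nat_def add_Suc_right add_Suc Nat.add_0_right)
  then show ?thesis by (simp del: meander.simps add: power_mult_distrib)
qed

text \<open>Positive mass is lost only through down-steps from \<open>1\<close> to \<open>0\<close>,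
  whose weights \<open>meander_1\<close> supplies. The term \<open>p * meander p q h 0\<close>
  contributes only at \<open>h = 0\<close>, where it accounts for a first step that has to go up. As
  \<open>h \<le> n\<close>, no height above \<open>n\<close> carries weight.\<close>

lemma meander_survival:
  assumes "p + q = 1" "h \<le> n"
  shows "(\<Sum>s=1..n. meander p q h s) + p * meander p q h 0 =
    p - (\<Sum>i | 2 * i + 2 \<le> h. catalan i * (p * q) ^ (i + 1))"
  using assms(2)
proof (induction h)
  case 0
  then show ?case by simp
next
  case (Suc h)
  have fin: "finite {i::nat. 2 * i + 2 \<le> m}" for m
    by (rule finite_subset[of _ "{..m}"]) auto
  obtain n' where n': "n = Suc n'" using Suc.prems by (cases n) auto
  have "(\<Sum>s=1..n. meander p q (Suc h) s) = (\<Sum>s\<le>n'. p * meander p q h s + q * meander p q h (s + 2))"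
    unfolding n' One_nat_def sum.atLeast1_atMost_eq lessThan_Suc_atMost by simp
  also have "\<dots> = p * (\<Sum>s\<le>n'. meander p q h s) + q * (\<Sum>s\<le>n'. meander p q h (s + 2))"
    by (simp add: sum.distrib sum_distrib_left)
  also have "(\<Sum>s\<le>n'. meander p q h s) = meander p q h 0 + (\<Sum>s=1..n. meander p q h s)"
  proof -
    have "(\<Sum>s\<le>n. meander p q h s) = (\<Sum>s\<le>n'. meander p q h s)"
      using meander_gt[of h n] Suc.prems by (simp add: n')
    then show ?thesis
      unfolding One_nat_def sum.atLeast1_atMost_eq by (simp add: sum.atMost_shift)
  qed
  also have "(\<Sum>s\<le>n'. meander p q h (s + 2)) = (\<Sum>s=1..n. meander p q h s) - meander p q h 1"
  proof -
    have "(\<Sum>s=1..n + 1. meander p q h s) = meander p q h 1 + (\<Sum>s\<le>n'. meander p q h (s + 2))"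
      unfolding n' One_nat_def add_Suc_right Nat.add_0_right sum.atLeast1_atMost_eq
      by (subst sum.lessThan_Suc_shift) (simp add: lessThan_Suc_atMost del: sum.lessThan_Suc)
    moreover have "(\<Sum>s=1..n + 1. meander p q h s) = (\<Sum>s=1..n. meander p q h s)"
      using meander_gt[of h "n + 1"] Suc.prems by simp
    ultimately show ?thesis by simp
  qed
  finally have step: "(\<Sum>s=1..n. meander p q (Suc h) s)
      = (\<Sum>s=1..n. meander p q h s) + p * meander p q h 0 - q * meander p q h 1"
    using assms(1) by (simp add: algebra_simps) (metis distrib_right mult_1 add.commute)
  \<comment> \<open>A new return time appears only when \<open>h\<close> is odd; for even
    \<open>h\<close> the weight at height \<open>1\<close> vanishes by parity.\<close>
  have ret: "(\<Sum>i | 2 * i + 2 \<le> Suc h. catalan i * (p * q) ^ (i + 1))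
      = (\<Sum>i | 2 * i + 2 \<le> h. catalan i * (p * q) ^ (i + 1)) + q * meander p q h 1"
  proof (cases "odd h")
    case True
    then obtain j where j: "h = 2 * j + 1" by (rule oddE)
    then have set: "{i. 2 * i + 2 \<le> Suc h} = insert j {i. 2 * i + 2 \<le> h}" by auto
    have "(\<Sum>i | 2 * i + 2 \<le> Suc h. catalan i * (p * q) ^ (i + 1))
        = catalan j * (p * q) ^ (j + 1) + (\<Sum>i | 2 * i + 2 \<le> h. catalan i * (p * q) ^ (i + 1))"
      unfolding set by (rule sum.insert[OF fin]) (simp add: j)
    then show ?thesis unfolding j meander_1 by simp
  next
    case False
    then have "{i. 2 * i + 2 \<le> Suc h} = {i. 2 * i + 2 \<le> h}" by (auto elim!: evenE) presburger
    then show ?thesis using meander_parity[of h 1 p q] False by simp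
  qed
  show ?case using step ret Suc by simp
qed

section \<open>One-step recursion for position and sojourn time\<close>

text \<open>This is \<open>pos_step\<close> as a function of the old position \<open>a\<close> and
  the new position \<open>b\<close> alone, so that position and sojourn time together evolve as a
  Markov chain.\<close>

definition gain :: "int \<Rightarrow> int \<Rightarrow> nat" where
  "gain a b = (if b > 0 \<or> b = 0 \<and> a > 0 then 1 else 0)"

lemma walk_Suc: "walk X (Suc n) \<omega> = walk X n \<omega> + X (Suc n) \<omega>"
  by (simp add: walk_def)

lemma sojourn_Suc: "sojourn X (Suc n) \<omega> = sojourn X n \<omega> + gain (walk X n \<omega>) (walk X (Suc n) \<omega>)"
  by (simp add: sojourn_def pos_step_def gain_def)

lemma sojourn_le: "sojourn X n \<omega> \<le> n"
  by (induction n) (auto simp: sojourn_Suc gain_def, simp add: sojourn_def)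

text \<open>The two sample spaces may differ, so a path can be compared with its own vector of
  steps, read as a walk on a one-point space.\<close>

lemma walk_cong: "(\<And>j. 1 \<le> j \<Longrightarrow> j \<le> n \<Longrightarrow> X j \<omega> = Y j \<eta>) \<Longrightarrow> walk X n \<omega> = walk Y n \<eta>"
  unfolding walk_def by (intro sum.cong) auto

lemma sojourn_cong:
  "(\<And>j. 1 \<le> j \<Longrightarrow> j \<le> n \<Longrightarrow> X j \<omega> = Y j \<eta>) \<Longrightarrow> sojourn X n \<omega> = sojourn Y n \<eta>"
proof (induction n)
  case 0
  show ?case by (simp add: sojourn_def)
next
  case (Suc n)
  have "walk X n \<omega> = walk Y n \<eta>" "walk X (Suc n) \<omega> = walk Y (Suc n) \<eta>"
    using Suc.prems by (auto intro!: walk_cong)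
  with Suc show ?case by (simp add: sojourn_Suc)
qed

locale bernoulli_walk = prob_space M for M :: "'w measure" +
  fixes X :: "nat \<Rightarrow> 'w \<Rightarrow> int" and p q :: real
  assumes pq: "p + q = 1"
    and indep: "indep_vars (\<lambda>_. count_space UNIV) X {1..}"
    and up: "j \<ge> 1 \<Longrightarrow> \<P>(\<omega> in M. X j \<omega> = 1) = p"
    and down: "j \<ge> 1 \<Longrightarrow> \<P>(\<omega> in M. X j \<omega> = - 1) = q"
begin

definition joint :: "nat \<Rightarrow> int \<Rightarrow> nat \<Rightarrow> real" where
  "joint n s k = \<P>(\<omega> in M. walk X n \<omega> = s \<and> sojourn X n \<omega> = k)"

lemma measurable_X [measurable]: "j \<ge> 1 \<Longrightarrow> X j \<in> measurable M (count_space UNIV)"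
  using indep by (simp add: indep_vars_def2)

text \<open>Past position and sojourn time are functions of the steps indexed by
  \<open>{1..n}\<close>, a block disjoint from \<open>{Suc n}\<close>.\<close>

lemma indep_past_next:
  "\<P>(\<omega> in M. P (walk X n \<omega>) (sojourn X n \<omega>) \<and> X (Suc n) \<omega> = x)
   = \<P>(\<omega> in M. P (walk X n \<omega>) (sojourn X n \<omega>)) * \<P>(\<omega> in M. X (Suc n) \<omega> = x)"
proof -
  let ?R = "\<lambda>A \<omega>. restrict (\<lambda>i. X i \<omega>) A"
  let ?past = "{f \<in> PiE {1..n} (\<lambda>_. UNIV). P (walk (\<lambda>i (_ :: unit). f i) n ()) (sojourn (\<lambda>i (_ :: unit). f i) n ())}"
  let ?next = "{f \<in> PiE {Suc n} (\<lambda>_. UNIV). f (Suc n) = x}"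
  \<comment> \<open>A finite product of copies of the countable discrete space \<open>int\<close> is
    discrete, so all sets of step vectors are measurable.\<close>
  have sets: "sets (PiM A (\<lambda>_. count_space (UNIV :: int set))) = Pow (PiE A (\<lambda>_. UNIV))"
    if "finite A" for A :: "nat set"
    using that by (subst count_space_PiM_finite) auto
  have w: "walk (\<lambda>i (_ :: unit). ?R {1..n} \<omega> i) n () = walk X n \<omega>"
    and t: "sojourn (\<lambda>i (_ :: unit). ?R {1..n} \<omega> i) n () = sojourn X n \<omega>" for \<omega>
    by (auto intro: walk_cong sojourn_cong)
  have "indep_var (PiM {1..n} (\<lambda>_. count_space UNIV)) (?R {1..n})
                  (PiM {Suc n} (\<lambda>_. count_space UNIV)) (?R {Suc n})"
    by (rule indep_var_restrict[OF indep]) auto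
  then have "prob ((\<lambda>\<omega>. (?R {1..n} \<omega>, ?R {Suc n} \<omega>)) -` (?past \<times> ?next) \<inter> space M)
      = prob (?R {1..n} -` ?past \<inter> space M) * prob (?R {Suc n} -` ?next \<inter> space M)"
    by (rule indep_varD) (subst sets; auto)+
  moreover have "(\<lambda>\<omega>. (?R {1..n} \<omega>, ?R {Suc n} \<omega>)) -` (?past \<times> ?next) \<inter> space M
      = {\<omega> \<in> space M. P (walk X n \<omega>) (sojourn X n \<omega>) \<and> X (Suc n) \<omega> = x}"
    unfolding vimage_def mem_Times_iff mem_Collect_eq fst_conv snd_conv w t by auto
  moreover have "?R {1..n} -` ?past \<inter> space M = {\<omega> \<in> space M. P (walk X n \<omega>) (sojourn X n \<omega>)}"
    unfolding vimage_def mem_Times_iff mem_Collect_eq fst_conv snd_conv w t by auto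
  moreover have "?R {Suc n} -` ?next \<inter> space M = {\<omega> \<in> space M. X (Suc n) \<omega> = x}"
    by auto
  ultimately show ?thesis by simp
qed

lemma measurable_walk [measurable]: "walk X n \<in> measurable M (count_space UNIV)"
proof (induction n)
  case 0
  show ?case by (simp add: walk_def)
next
  case (Suc n)
  note [measurable] = Suc
  have [measurable]: "X (Suc n) \<in> measurable M (count_space UNIV)" by simp
  show ?case unfolding walk_Suc[abs_def] by measurable
qed

lemma measurable_sojourn [measurable]: "sojourn X n \<in> measurable M (count_space UNIV)"
proof (induction n)
  case 0
  show ?case by (simp add: sojourn_def)
next
  case (Suc n)
  note [measurable] = Suc
  show ?case unfolding sojourn_Suc[abs_def] gain_def by measurable
qed

lemma AE_step: assumes "j \<ge> 1" shows "AE \<omega> in M. X j \<omega> = 1 \<or> X j \<omega> = - 1"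
proof -
  note [measurable] = measurable_X[OF assms]
  have "prob {\<omega> \<in> space M. X j \<omega> = 1 \<or> X j \<omega> = - 1}
      = prob ({\<omega> \<in> space M. X j \<omega> = 1} \<union> {\<omega> \<in> space M. X j \<omega> = - 1})"
    by (intro arg_cong[where f = prob]) auto
  also have "\<dots> = 1"
    using up[OF assms] down[OF assms] pq by (subst finite_measure_Union) auto
  finally show ?thesis
    by (subst (asm) prob_Collect_eq_1) auto
qed

lemma joint_0: "joint 0 s k = (if s = 0 \<and> k = 0 then 1 else 0)"
  by (auto simp: joint_def walk_def sojourn_def prob_space)

text \<open>Condition on the last step, which is almost surely \<open>1\<close> or
  \<open>- 1\<close> and independent of the past. The tests against \<open>k\<close> guard the
  truncated subtraction.\<close>

lemma joint_Suc:
  "joint (Suc n) s k =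
     (if gain (s - 1) s \<le> k then p * joint n (s - 1) (k - gain (s - 1) s) else 0)
   + (if gain (s + 1) s \<le> k then q * joint n (s + 1) (k - gain (s + 1) s) else 0)"
proof -
  have [measurable]: "X (Suc n) \<in> measurable M (count_space UNIV)" by simp
  let ?E = "\<lambda>x. {\<omega> \<in> space M. (walk X n \<omega> = s - x \<and> sojourn X n \<omega> + gain (s - x) s = k) \<and> X (Suc n) \<omega> = x}"
  have "joint (Suc n) s k = prob (?E 1 \<union> ?E (- 1))"
    unfolding joint_def
  proof (rule finite_measure_eq_AE)
    show "AE \<omega> in M. (\<omega> \<in> {\<omega> \<in> space M. walk X (Suc n) \<omega> = s \<and> sojourn X (Suc n) \<omega> = k})
        = (\<omega> \<in> ?E 1 \<union> ?E (- 1))"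
      using AE_step[of "Suc n"] by (auto simp: walk_Suc sojourn_Suc)
  qed measurable
  also have "\<dots> = prob (?E 1) + prob (?E (- 1))"
    by (rule finite_measure_Union) (measurable, auto)
  finally have split: "joint (Suc n) s k = prob (?E 1) + prob (?E (- 1))" .
  have event: "prob (?E x) = (if gain (s - x) s \<le> k then joint n (s - x) (k - gain (s - x) s) else 0)
      * \<P>(\<omega> in M. X (Suc n) \<omega> = x)" for x
  proof -
    have "{\<omega> \<in> space M. walk X n \<omega> = s - x \<and> sojourn X n \<omega> + gain (s - x) s = k}
      = (if gain (s - x) s \<le> k then {\<omega> \<in> space M. walk X n \<omega> = s - x \<and> sojourn X n \<omega> = k - gain (s - x) s} else {})"
      by auto
    then show ?thesis
      by (subst indep_past_next[of "\<lambda>a b. a = s - x \<and> b + gain (s - x) s = k"]) (auto simp: joint_def)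
  qed
  show ?thesis
    unfolding split event using up[of "Suc n"] down[of "Suc n"] by (simp add: mult.commute)
qed

lemma joint_gt: "k > n \<Longrightarrow> joint n s k = 0"
  using sojourn_le[of X n] by (metis (mono_tags, lifting) joint_def empty_Collect_eq measure_empty not_le)

lemma sojourn_prob_sum: "sojourn_prob M X k n = (\<Sum>s=-int n..int n. joint n s k)"
proof -
  \<comment> \<open>Steps other than \<plusminus>1 are excluded only almost surely, hence so are
    positions out of range.\<close>
  have bound: "AE \<omega> in M. walk X n \<omega> \<in> {-int n..int n}"
  proof (induction n)
    case (Suc n)
    with AE_step[of "Suc n"] show ?case by (auto simp: walk_Suc)
  qed (simp add: walk_def)
  let ?E = "\<lambda>s. {\<omega> \<in> space M. walk X n \<omega> = s \<and> sojourn X n \<omega> = k}"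
  have "sojourn_prob M X k n = prob (\<Union>s\<in>{-int n..int n}. ?E s)"
    unfolding sojourn_prob_def
    by (rule finite_measure_eq_AE) (use bound in auto)
  also have "\<dots> = (\<Sum>s=-int n..int n. prob (?E s))"
    by (rule finite_measure_finite_Union) (auto simp: disjoint_family_on_def)
  finally show ?thesis by (simp add: joint_def)
qed

end

section \<open>Weights split at the last zero\<close>

text \<open>For \<open>s > 0\<close> this is the weight of the paths from \<open>0\<close> to \<open>s\<close> with \<open>k\<close> positive and \<open>l\<close>
  negative steps in the sense of \<^const>\<open>gain\<close>, split at the last visit \<open>2 * m\<close> to \<open>0\<close>: by the
  Chung-Feller theorem the bridges of length \<open>2 * m\<close> with \<open>l\<close> negative steps have weight
  \<open>catalan m * (p * q) ^ m\<close> for every even \<open>l \<le> 2 * m\<close>.\<close>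

definition one_sided :: "real \<Rightarrow> real \<Rightarrow> nat \<Rightarrow> nat \<Rightarrow> nat \<Rightarrow> real" where
  "one_sided p q k l s = (if even l then
     \<Sum>m | l \<le> 2 * m \<and> 2 * m \<le> k + l. catalan m * (p * q) ^ m * meander p q (k + l - 2 * m) s else 0)"

lemma finite_double_between: "finite {m. l \<le> 2 * m \<and> 2 * m \<le> (n::nat)}"
  by (rule finite_subset[of _ "{..n}"]) auto

text \<open>A step that ends at a positive height counts as positive and leaves the last zero alone:
  \<open>k\<close> grows, \<open>l\<close> and \<open>m\<close> stay, and the recursion of
  \<open>meander\<close> passes through the sum.\<close>

lemma one_sided_Suc:
  "one_sided p q (Suc k) l (Suc s) = p * one_sided p q k l s + q * one_sided p q k l (s + 2)"
proof (cases "even l")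
  case True
  let ?A = "\<lambda>n. {m. l \<le> 2 * m \<and> 2 * m \<le> n}"
  \<comment> \<open>The one possible extra index has \<open>2 * m = Suc k + l\<close>, where a path
    of length \<open>0\<close> cannot be at height \<open>Suc s\<close>.\<close>
  have "(\<Sum>m\<in>?A (Suc k + l). catalan m * (p * q) ^ m * meander p q (Suc k + l - 2 * m) (Suc s))
      = (\<Sum>m\<in>?A (k + l). catalan m * (p * q) ^ m * meander p q (Suc k + l - 2 * m) (Suc s))"
    by (rule sum.mono_neutral_right)
      (use finite_double_between in \<open>auto simp: not_le Suc_le_eq less_Suc_eq\<close>)
  also have "\<dots> = (\<Sum>m\<in>?A (k + l). p * (catalan m * (p * q) ^ m * meander p q (k + l - 2 * m) s)
      + q * (catalan m * (p * q) ^ m * meander p q (k + l - 2 * m) (s + 2)))"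
    by (rule sum.cong) (auto simp: Suc_diff_le algebra_simps)
  finally show ?thesis
    using True by (simp add: one_sided_def sum.distrib sum_distrib_left)
qed (simp add: one_sided_def)

lemma one_sided_0: "one_sided p q 0 l (Suc s) = 0"
  by (auto simp: one_sided_def intro!: sum.neutral)

text \<open>A nonempty positive path cannot end at \<open>0\<close>, so only
  \<open>2 * m = k + l\<close> survives.\<close>

lemma one_sided_bridge:
  "one_sided p q k l 0 = (if even k \<and> even l then catalan ((k + l) div 2) * (p * q) ^ ((k + l) div 2) else 0)"
proof (cases "even k \<and> even l")
  case True
  let ?m = "(k + l) div 2"
  have m: "2 * ?m = k + l" using True by auto
  have "one_sided p q k l 0 = (\<Sum>m\<in>{?m}. catalan m * (p * q) ^ m * meander p q (k + l - 2 * m) 0)"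
    unfolding one_sided_def if_P[OF conjunct2[OF True]]
    by (rule sum.mono_neutral_right) (use m in \<open>auto intro!: finite_double_between meander_0\<close>)
  then show ?thesis using True m by simp
next
  case False
  then show ?thesis
    by (auto simp: one_sided_def intro!: sum.neutral meander_parity)
qed

text \<open>A positive and a negative last excursion contribute complementary parts of the Catalan
  convolution, which is why the bridge weight does not depend on \<open>k\<close> and \<open>l\<close> separately.\<close>

lemma one_sided_bridge_rec:
  assumes "k + l > 0"
  shows "one_sided p q k l 0 = (if l = 0 then 0 else p * one_sided q p (l - 1) k 1)
    + (if k = 0 then 0 else q * one_sided p q (k - 1) l 1)"
proof (cases "even k \<and> even l")
  case True
  then obtain a b where ab: "k = 2 * a" "l = 2 * b" by (auto elim!: evenE)
  obtain n where n: "a + b = Suc n" using assms ab by (cases "a + b") auto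
  \<comment> \<open>Here \<open>2 * m\<close> is the last zero before the final one, and the closing
    positive excursion has weight \<open>catalan (n - m) * (p * q) ^ (n - m + 1)\<close>. All
    parameters are general so that the negative side is an instance too.\<close>
  have half: "(if k = 0 then 0 else q * one_sided p q (k - 1) l 1)
      = (\<Sum>m=b..n. catalan m * catalan (n - m)) * (p * q) ^ Suc n"
    if k: "k = 2 * a" and l: "l = 2 * b" and n: "a + b = Suc n" for p q :: real and k l a b
  proof (cases "k = 0")
    case True
    then show ?thesis using k n by simp
  next
    case False
    then have set: "{m. l \<le> 2 * m \<and> 2 * m \<le> k - 1 + l} = {b..n}"
      using k l n by auto
    have "q * one_sided p q (k - 1) l 1
        = (\<Sum>m=b..n. catalan m * (p * q) ^ m * (q * meander p q (k - 1 + l - 2 * m) 1))"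
      unfolding one_sided_def set using l by (simp add: sum_distrib_left mult_ac)
    also have "\<dots> = (\<Sum>m=b..n. catalan m * catalan (n - m) * (p * q) ^ Suc n)"
    proof (rule sum.cong)
      fix m assume m: "m \<in> {b..n}"
      then have h: "k - 1 + l - 2 * m = 2 * (n - m) + 1" using k l n False by auto
      have "catalan m * (p * q) ^ m * (q * meander p q (k - 1 + l - 2 * m) 1)
          = catalan m * catalan (n - m) * ((p * q) ^ m * (p * q) ^ (n - m + 1))"
        unfolding h meander_1 by (simp only: mult_ac)
      also have "(p * q) ^ m * (p * q) ^ (n - m + 1) = (p * q) ^ Suc n"
        using m by (simp flip: power_add)
      finally show "catalan m * (p * q) ^ m * (q * meander p q (k - 1 + l - 2 * m) 1)
          = catalan m * catalan (n - m) * (p * q) ^ Suc n" .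
    qed simp
    finally show ?thesis using False by (simp add: sum_distrib_right)
  qed
  \<comment> \<open>Reversing \<open>m\<close> to \<open>n - m\<close> maps \<open>{a..n}\<close>
    onto the indices below \<open>b\<close>, as \<open>a + b = Suc n\<close>.\<close>
  have "(\<Sum>m=a..n. catalan m * catalan (n - m)) = (\<Sum>m<b. catalan m * catalan (n - m))"
    by (rule sum.reindex_bij_witness[where i = "\<lambda>m. n - m" and j = "\<lambda>m. n - m"]) (use n in auto)
  moreover have "{..n} = {..<b} \<union> {b..n}" using n by auto
  then have "(\<Sum>m\<le>n. catalan m * catalan (n - m))
      = (\<Sum>m<b. catalan m * catalan (n - m)) + (\<Sum>m=b..n. catalan m * catalan (n - m))"
    by (simp only:) (rule sum.union_disjoint, auto)
  ultimately have "(if l = 0 then 0 else p * one_sided q p (l - 1) k 1)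
      + (if k = 0 then 0 else q * one_sided p q (k - 1) l 1) = catalan (Suc n) * (p * q) ^ Suc n"
    unfolding half[OF ab n] half[OF ab(2,1) n[unfolded add.commute[of a]]] catalan_convolution[symmetric]
    by (simp add: distrib_right mult.commute[of q p])
  moreover have "(k + l) div 2 = Suc n" using ab n by auto
  ultimately show ?thesis using True by (simp add: one_sided_bridge)
next
  case False
  \<comment> \<open>The length left after the last zero is even, so height \<open>1\<close> is
    excluded by parity.\<close>
  have step: "one_sided p q (k - 1) l 1 = 0" if "odd k" "even l" for p q k l
    using odd_pos[OF that(1)] that unfolding one_sided_def
    by (auto intro!: sum.neutral meander_parity simp del: One_nat_def)
  have odd: "one_sided p q k l s = 0" if "odd l" for p q k l s
    using that by (simp add: one_sided_def)
  have "one_sided q p (l - 1) k 1 = 0"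
    by (cases "even k") (use False step[of l k q p] odd[of k q p "l - 1" 1] in simp_all)
  moreover have "one_sided p q (k - 1) l 1 = 0"
    by (cases "even l") (use False step[of k l p q] odd[of l p q "k - 1" 1] in simp_all)
  moreover have "one_sided p q k l 0 = 0"
    unfolding one_sided_bridge using False by (rule if_not_P)
  ultimately show ?thesis by (simp only: mult_zero_right if_cancel add_0)
qed

lemma one_sided_bridge_swap: "one_sided p q k l 0 = one_sided q p l k 0"
  by (auto simp: one_sided_bridge add.commute mult.commute)

section \<open>The joint law of position and sojourn time\<close>

context bernoulli_walk
begin

text \<open>Reflecting the walk exchanges \<open>p\<close> with \<open>q\<close> and
  \<open>k\<close> with \<open>n - k\<close>, which gives the branch \<open>s < 0\<close>. The
  induction step is \<open>one_sided_Suc\<close> away from \<open>0\<close> and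
  \<open>one_sided_bridge_rec\<close> at \<open>0\<close>.\<close>

lemma joint_eq:
  "joint n s k = (if k \<le> n then
     (if s \<ge> 0 then one_sided p q k (n - k) (nat s) else one_sided q p (n - k) k (nat (- s))) else 0)"
proof (induction n arbitrary: s k)
  case 0
  then show ?case by (auto simp: joint_0 one_sided_def)
next
  case (Suc n)
  show ?case
  proof (cases "k \<le> Suc n")
    case k: True
    consider "s > 0" | "s = 0" | "s < 0" by linarith
    then show ?thesis
    proof cases
      case 1
      then have "s = int (Suc (nat s - 1))" by simp
      then obtain t where t: "s = int (Suc t)" ..
      then show ?thesis
      proof (cases k)
        case 0
        have "nat s = Suc t" using t by simp
        then show ?thesis using 0 t by (simp add: joint_Suc gain_def one_sided_0)
      next
        case (Suc k')
        have "nat (s - 1) = t" "nat (s + 1) = t + 2" "nat s = Suc t" using t by auto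
        then show ?thesis
          using t k Suc one_sided_Suc[of p q k' "n - k'" t]
          by (simp add: joint_Suc gain_def Suc.IH)
      qed
    next
      case 2
      \<comment> \<open>Arriving at \<open>0\<close> from \<open>- 1\<close> is a negative step and
        from \<open>1\<close> a positive one, so only the latter uses up a unit of
        \<open>k\<close>.\<close>
      have "joint (Suc n) 0 k = (if k = Suc n then 0 else p * one_sided q p (n - k) k 1)
          + (if k = 0 then 0 else q * one_sided p q (k - 1) (n - (k - 1)) 1)"
        using k by (auto simp: joint_Suc gain_def Suc.IH)
      then show ?thesis
        using 2 k one_sided_bridge_rec[of k "Suc n - k" p q]
        by (auto simp: Suc_diff_le)
    next
      case 3
      then have "s = - int (Suc (nat (- s) - 1))" by simp
      then obtain t where t: "s = - int (Suc t)" ..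
      have nats: "nat (- (s - 1)) = t + 2" "nat (- s) = Suc t" using t by auto
      \<comment> \<open>For \<open>t = 0\<close> the neighbour is \<open>0\<close>, where the
        induction hypothesis gives the weight seen from the positive side;
        \<open>one_sided_bridge_swap\<close> converts it.\<close>
      have up: "joint n (s + 1) k = (if k \<le> n then one_sided q p (n - k) k t else 0)"
      proof -
        have "s + 1 = - int t" using t by simp
        then show ?thesis
          using one_sided_bridge_swap[of p q k "n - k"] by (simp only: Suc.IH) simp
      qed
      show ?thesis
      proof (cases "k = Suc n")
        case True
        then show ?thesis using 3 nats by (simp add: joint_Suc joint_gt gain_def one_sided_0)
      next
        case False
        then have "k \<le> n" using k by simp
        have "joint (Suc n) s k = p * joint n (s - 1) k + q * joint n (s + 1) k"
          using 3 by (simp add: joint_Suc gain_def)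
        also have "\<dots> = p * one_sided q p (n - k) k (t + 2) + q * one_sided q p (n - k) k t"
          unfolding up using 3 nats \<open>k \<le> n\<close> by (simp add: Suc.IH)
        also have "\<dots> = one_sided q p (Suc n - k) k (Suc t)"
          using \<open>k \<le> n\<close> by (simp add: Suc_diff_le one_sided_Suc)
        finally show ?thesis using 3 nats k by simp
      qed
    qed
  qed (simp add: joint_gt)
qed

end

section \<open>Summation over the final position\<close>

text \<open>The bridge weight at \<open>s = 0\<close> is divided between the two sides in the proportion \<open>p : q\<close>.\<close>

lemma one_sided_sum:
  assumes "p + q = 1" "k + l = n"
  shows "(\<Sum>s=1..n. one_sided p q k l s) + p * one_sided p q k l 0 =
    indicator Evens l *
      (2 * p * (\<Sum>i | i \<in> Evens \<and> l \<le> i \<and> i \<le> n. acoeff i * (p * q) ^ (i div 2))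
       - 4 * (\<Sum>i | i \<in> Evens \<and> l \<le> i \<and> i + 2 \<le> n.
           (\<Sum>j | j \<in> Evens \<and> j \<le> i - l. acoeff j * acoeff (i - j)) * (p * q) ^ (i div 2 + 1)))"
proof (cases "even l")
  case False
  then show ?thesis by (simp add: one_sided_def Evens_def)
next
  case True
  let ?x = "p * q"
  let ?A = "{m. l \<le> 2 * m \<and> 2 * m \<le> n}"
  let ?B = "\<lambda>h. {i. 2 * i + 2 \<le> (h::nat)}"
  have finA: "finite ?A" by (rule finite_double_between)
  have finB: "finite (?B h)" for h by (rule finite_subset[of _ "{..h}"]) auto
  \<comment> \<open>Exchanging the sums collects, for each last zero \<open>2 * m\<close>, exactly
    the left side of \<open>meander_survival\<close> for the remaining \<open>n - 2 * m\<close>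
    steps.\<close>
  have "(\<Sum>s=1..n. one_sided p q k l s) + p * one_sided p q k l 0
      = (\<Sum>m\<in>?A. catalan m * ?x ^ m * ((\<Sum>s=1..n. meander p q (n - 2 * m) s) + p * meander p q (n - 2 * m) 0))"
    unfolding one_sided_def assms(2) if_P[OF True]
    by (subst sum.swap) (simp add: sum_distrib_left sum.distrib algebra_simps)
  also have "\<dots> = (\<Sum>m\<in>?A. catalan m * ?x ^ m * (p - (\<Sum>i\<in>?B (n - 2 * m). catalan i * ?x ^ (i + 1))))"
    by (intro sum.cong refl arg_cong2[where f = "(*)"] meander_survival[OF assms(1)]) simp
  also have "\<dots> = p * (\<Sum>m\<in>?A. catalan m * ?x ^ m)
      - (\<Sum>m\<in>?A. \<Sum>i\<in>?B (n - 2 * m). catalan i * catalan m * ?x ^ (m + i + 1))"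
    by (simp add: right_diff_distrib sum_subtractf sum_distrib_left power_add mult_ac)
  also have "p * (\<Sum>m\<in>?A. catalan m * ?x ^ m)
      = 2 * p * (\<Sum>i | i \<in> Evens \<and> l \<le> i \<and> i \<le> n. acoeff i * ?x ^ (i div 2))"
  proof -
    have "(\<Sum>m\<in>?A. catalan m * ?x ^ m / 2) = (\<Sum>i | i \<in> Evens \<and> l \<le> i \<and> i \<le> n. acoeff i * ?x ^ (i div 2))"
      by (rule sum.reindex_bij_witness[where i = "\<lambda>i. i div 2" and j = "\<lambda>m. 2 * m"])
        (auto simp: Evens_def acoeff_even)
    then show ?thesis by (simp flip: sum_divide_distrib)
  qed
  also have "(\<Sum>m\<in>?A. \<Sum>i\<in>?B (n - 2 * m). catalan i * catalan m * ?x ^ (m + i + 1))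
      = 4 * (\<Sum>i | i \<in> Evens \<and> l \<le> i \<and> i + 2 \<le> n.
           (\<Sum>j | j \<in> Evens \<and> j \<le> i - l. acoeff j * acoeff (i - j)) * ?x ^ (i div 2 + 1))"
  proof -
    let ?I = "{i. i \<in> Evens \<and> l \<le> i \<and> i + 2 \<le> n}"
    let ?J = "\<lambda>i. {j. j \<in> Evens \<and> j \<le> i - l}"
    have finI: "finite ?I" by (rule finite_subset[of _ "{..n}"]) auto
    have finJ: "finite (?J i)" for i by (rule finite_subset[of _ "{..i}"]) auto
    have "(\<Sum>m\<in>?A. \<Sum>i\<in>?B (n - 2 * m). catalan i * catalan m * ?x ^ (m + i + 1))
        = (\<Sum>(m, i)\<in>(SIGMA m:?A. ?B (n - 2 * m)). catalan i * catalan m * ?x ^ (m + i + 1))"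
      using finA finB by (simp add: sum.Sigma)
    \<comment> \<open>The outer index becomes \<open>2 * (m + i)\<close> and the inner one
      \<open>2 * i\<close>, so \<open>l \<le> 2 * m\<close> turns into \<open>j \<le> i - l\<close>.
      The factor \<open>4\<close> comes from two Catalan numbers, each twice an
      \<open>acoeff\<close>.\<close>
    also have "\<dots> = (\<Sum>(i, j)\<in>(SIGMA i:?I. ?J i). 4 * (acoeff j * acoeff (i - j) * ?x ^ (i div 2 + 1)))"
    proof (rule sum.reindex_bij_witness[where
        i = "\<lambda>(i, j). ((i - j) div 2, j div 2)" and j = "\<lambda>(m, i). (2 * (m + i), 2 * i)"], goal_cases)
      case (1 a)
      then show ?case by auto
    next
      case (2 a)
      then show ?case by (auto simp: Evens_def)
    next
      case (3 b)
      then show ?case by (auto simp: Evens_def elim!: evenE)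
    next
      case (4 b)
      then show ?case using True by (auto simp: Evens_def elim!: evenE)
    next
      case (5 a)
      obtain m i where a: "a = (m, i)" by fastforce
      have "2 * (m + i) - 2 * i = 2 * m" by simp
      then show ?case unfolding a prod.case acoeff_even by (simp only: acoeff_even) simp
    qed
    also have "\<dots> = (\<Sum>i\<in>?I. \<Sum>j\<in>?J i. 4 * (acoeff j * acoeff (i - j) * ?x ^ (i div 2 + 1)))"
      using finI finJ by (simp add: sum.Sigma)
    finally show ?thesis by (simp add: sum_distrib_left sum_distrib_right)
  qed
  finally show ?thesis using True by (simp add: Evens_def)
qed

text \<open>Positive and negative final positions are two instances of \<open>one_sided_sum\<close>,
  the second with \<open>p\<close>, \<open>q\<close> and \<open>k\<close>, \<open>n - k\<close>
  exchanged.\<close>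

lemma (in bernoulli_walk) sojourn_prob_eq:
  assumes "k \<le> n"
  shows "sojourn_prob M X k n =
       indicator Evens (n - k) *
       (2 * p * (\<Sum>i | i \<in> Evens \<and> n - k \<le> i \<and> i \<le> n. acoeff i * (p * q) ^ (i div 2))
        - 4 * (\<Sum>i | i \<in> Evens \<and> n - k \<le> i \<and> i + 2 \<le> n.
            (\<Sum>j | j \<in> Evens \<and> j \<le> i + k - n. acoeff j * acoeff (i - j)) * (p * q) ^ (i div 2 + 1)))
      + indicator Evens k *
       (2 * q * (\<Sum>i | i \<in> Evens \<and> k \<le> i \<and> i \<le> n. acoeff i * (p * q) ^ (i div 2))
        - 4 * (\<Sum>i | i \<in> Evens \<and> k \<le> i \<and> i + 2 \<le> n.
            (\<Sum>j | j \<in> Evens \<and> j \<le> i - k. acoeff j * acoeff (i - j)) * (p * q) ^ (i div 2 + 1)))"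
proof -
  have "{- int n..int n} = insert 0 (int ` {1..n} \<union> (\<lambda>s. - int s) ` {1..n})"
  proof (intro equalityI subsetI)
    fix s assume "s \<in> {- int n..int n}"
    then show "s \<in> insert 0 (int ` {1..n} \<union> (\<lambda>s. - int s) ` {1..n})"
      by (cases s rule: int_cases2) (auto simp: image_iff)
  qed auto
  then have "sojourn_prob M X k n = joint n 0 k + ((\<Sum>s\<in>int ` {1..n}. joint n s k) + (\<Sum>s\<in>(\<lambda>s. - int s) ` {1..n}. joint n s k))"
    unfolding sojourn_prob_sum
    by (simp only:) (subst sum.insert; (subst sum.union_disjoint)?; auto)
  also have "\<dots> = one_sided p q k (n - k) 0
      + ((\<Sum>s=1..n. one_sided p q k (n - k) s) + (\<Sum>s=1..n. one_sided q p (n - k) k s))"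
    using assms by (auto simp: sum.reindex inj_on_def joint_eq intro!: arg_cong2[where f = "(+)"] sum.cong)
  also have "\<dots> = ((\<Sum>s=1..n. one_sided p q k (n - k) s) + p * one_sided p q k (n - k) 0)
      + ((\<Sum>s=1..n. one_sided q p (n - k) k s) + q * one_sided q p (n - k) k 0)"
    using distrib_right[of p q "one_sided p q k (n - k) 0"] unfolding pq one_sided_bridge_swap[of q p "n - k" k]
    by simp
  \<comment> \<open>As \<open>k \<le> n\<close>, the bound \<open>i - (n - k)\<close> becomes
    \<open>i + k - n\<close>.\<close>
  finally show ?thesis
    using assms pq
    by (simp only: one_sided_sum[of p q k "n - k" n] one_sided_sum[of q p "n - k" k n]
        mult.commute[of q p] add.commute[of q p] diff_diff_right le_add_diff_inverse le_add_diff_inverse2)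
qed

theorem theorem5p3:
  fixes M :: "'w measure" and X :: "nat \<Rightarrow> 'w \<Rightarrow> int" and p q :: real and k n :: nat
  assumes "prob_space M"
    and "0 < p" and "p < 1" and "q = 1 - p"
    and "prob_space.indep_vars M (\<lambda>_. count_space UNIV) X {1..}"
    and "\<And>j. j \<ge> 1 \<Longrightarrow> \<P>(\<omega> in M. X j \<omega> = 1) = p"
    and "\<And>j. j \<ge> 1 \<Longrightarrow> \<P>(\<omega> in M. X j \<omega> = - 1) = q"
    and "k \<le> n"
  shows
    "(sojourn_prob M X k n =
       indicator Evens (n - k) *
       (2 * p * (\<Sum>i | i \<in> Evens \<and> n - k \<le> i \<and> i \<le> n. acoeff i * (p * q) ^ (i div 2))
        - 4 * (\<Sum>i | i \<in> Evens \<and> n - k \<le> i \<and> i + 2 \<le> n.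
            (\<Sum>j | j \<in> Evens \<and> j \<le> i + k - n. acoeff j * acoeff (i - j)) * (p * q) ^ (i div 2 + 1)))
      + indicator Evens k *
       (2 * q * (\<Sum>i | i \<in> Evens \<and> k \<le> i \<and> i \<le> n. acoeff i * (p * q) ^ (i div 2))
        - 4 * (\<Sum>i | i \<in> Evens \<and> k \<le> i \<and> i + 2 \<le> n.
            (\<Sum>j | j \<in> Evens \<and> j \<le> i - k. acoeff j * acoeff (i - j)) * (p * q) ^ (i div 2 + 1))))
     \<and> (odd n \<and> odd k \<longrightarrow> sojourn_prob M X k n =
        2 * p * (\<Sum>i | i \<in> Evens \<and> n - k \<le> i \<and> i + 1 \<le> n. acoeff i * (p * q) ^ (i div 2))
        - 4 * (\<Sum>i | i \<in> Evens \<and> n - k \<le> i \<and> i + 3 \<le> n.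
            (\<Sum>j | j \<in> Evens \<and> j \<le> i + k - n. acoeff j * acoeff (i - j)) * (p * q) ^ (i div 2 + 1)))
     \<and> (odd n \<and> even k \<longrightarrow> sojourn_prob M X k n =
        2 * q * (\<Sum>i | i \<in> Evens \<and> k \<le> i \<and> i + 1 \<le> n. acoeff i * (p * q) ^ (i div 2))
        - 4 * (\<Sum>i | i \<in> Evens \<and> k \<le> i \<and> i + 3 \<le> n.
            (\<Sum>j | j \<in> Evens \<and> j \<le> i - k. acoeff j * acoeff (i - j)) * (p * q) ^ (i div 2 + 1)))
     \<and> (even n \<and> even k \<longrightarrow> sojourn_prob M X k n =
        2 * p * (\<Sum>i | i \<in> Evens \<and> n - k \<le> i \<and> i \<le> n. acoeff i * (p * q) ^ (i div 2))
        - 4 * (\<Sum>i | i \<in> Evens \<and> n - k \<le> i \<and> i + 2 \<le> n.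
            (\<Sum>j | j \<in> Evens \<and> j \<le> i + k - n. acoeff j * acoeff (i - j)) * (p * q) ^ (i div 2 + 1))
        + 2 * q * (\<Sum>i | i \<in> Evens \<and> k \<le> i \<and> i \<le> n. acoeff i * (p * q) ^ (i div 2))
        - 4 * (\<Sum>i | i \<in> Evens \<and> k \<le> i \<and> i + 2 \<le> n.
            (\<Sum>j | j \<in> Evens \<and> j \<le> i - k. acoeff j * acoeff (i - j)) * (p * q) ^ (i div 2 + 1)))
     \<and> (even n \<and> odd k \<longrightarrow> sojourn_prob M X k n = 0)"
proof -
  interpret prob_space M by fact
  interpret bernoulli_walk M X p q
    by unfold_locales (use assms in auto)
  \<comment> \<open>For odd \<open>n\<close> an even index never equals \<open>n\<close> or
    \<open>n - 2\<close>, so the upper bounds of the odd case describe the same index sets.\<close>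
  have le: "i \<in> Evens \<and> m \<le> i \<and> i + 1 \<le> n \<longleftrightarrow> i \<in> Evens \<and> m \<le> i \<and> i \<le> n"
    "i \<in> Evens \<and> m \<le> i \<and> i + 3 \<le> n \<longleftrightarrow> i \<in> Evens \<and> m \<le> i \<and> i + 2 \<le> n"
    if "odd n" for i m
    using that unfolding Evens_def mem_Collect_eq by presburger+
  have parity: "odd n \<Longrightarrow> odd k \<Longrightarrow> n - k \<in> Evens" "odd n \<Longrightarrow> even k \<Longrightarrow> n - k \<notin> Evens"
    "even n \<Longrightarrow> even k \<Longrightarrow> n - k \<in> Evens" "even n \<Longrightarrow> odd k \<Longrightarrow> n - k \<notin> Evens"
    "k \<in> Evens \<longleftrightarrow> even k"
    using \<open>k \<le> n\<close> by (auto simp: Evens_def)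
  note eq = sojourn_prob_eq[OF \<open>k \<le> n\<close>]
  show ?thesis
    by (intro conjI impI, rule eq)
      (use parity in \<open>simp_all add: eq le add_diff_eq del: One_nat_def add_Suc_right\<close>)
qed

end
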